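(* Let the difference equation, the numbers $\rho_i,e_i,k_i$, the integer $m$, the solution space $V_m$ and the subspaces $V_{m,i}^\vee$ ($1\le i\le s+1$) be as described in the context, and put $$V_{m,j}^\ast=V_{m,1}^\vee\oplus\cdots\oplus V_{m,j}^\vee,\qquad j=1,\ldots,s+1$$ (so $V_{m,1}^\ast=V_{m,1}^\vee$). Let $\theta\in\{1,\ldots,s\}$ and $k=\max(k_1,\ldots,k_s)$. Then there exists a constant $A^\ast>0$ such that $$\exp\bigl(-A^\ast(\ln(\nu)+\nu^{1-1/k})\bigr)\,(\rho_\theta)^{\nu}\,\omega_{n,y}(m)\le\omega_{n,y}(\nu)$$ for all $y\in V_{m,\theta}^\ast$ and all integers $\nu\ge m$.
   Context: Notation: $\mathbb N=\{1,2,3,\ldots\}$. Setting: let $s\ge 0$ be an integer, $n\in\mathbb N$, $a_i^\sim\in\mathbb C$ and $a_i(\nu)\in\mathbb C$ for $i=0,\ldots,n$ and integers $\nu\ge 0$, with $a_n(\nu)=1$ for all $\nu\ge0$ and $a_i(\nu)-a_i^\sim=O(1/(\nu+1))$ for $i=0,\ldots,n$ (so $a_n^\sim=1$). For $m\in\mathbb N$, $V_m$ denotes the $\mathbb C$-linear space of solutions $y=(y(\nu))_{\nu\ge m}$, $y(\nu)\in\mathbb C$, of $$\sum_{k=0}^n a_k(\nu)y(\nu+k)=0,\qquad \nu\ge m.$$ Let $T(z)=\sum_{k=0}^n a_k^\sim z^k$ be the characteristic polynomial. The absolute values of all roots of $T$ are assumed to be among the real numbers $\rho_1>\rho_2>\cdots>\rho_s>\rho_{s+1}=0$.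 For $i=1,\ldots,s+1$, $e_i$ and $k_i$ denote respectively the sum and the maximum of the multiplicities of those roots of $T$ whose absolute value equals $\rho_i$ (both $0$ if there are none); put $k^\ast=k_{s+1}$. It is assumed that $e_i>0$ for $i=1,\ldots,s$. For a sequence $y=(y(\nu))_{\nu\ge m}$ put $$\omega_{n,y}(\nu)=\max(|y(\nu)|,\ldots,|y(\nu+n-1)|).$$ Fix data as provided by the following previously known theorem: there exist $A>0$, $m\in\mathbb N$, numbers $\alpha(\nu)>0$ ($\nu\ge m$) with $\alpha(\nu)\to0$ as $\nu\to\infty$, and subspaces $V_{m,1}^\vee,\ldots,V_{m,s+1}^\vee$ of $V_m$ such that $V_m=V_{m,1}^\vee\oplus\cdots\oplus V_{m,s+1}^\vee$, $\dim_{\mathbb C}V_{m,i}^\vee=e_i$, and, with $$V_{m,j}^\wedge=V_{m,j}^\vee\oplus\cdots\oplus V_{m,s+1}^\vee\quad(1\le j\le s+1)$$ and $\pi_j:V_{m,j}^\wedge\to V_{m,j}^\vee$ ($1\le j\le s$) the natural projection (with kernel $V_{m,j+1}^\wedge$), the following hold for all $\nu\ge m$: (1) if $y\in V_{m,\theta}^\vee$ with $1\le\theta\le s$, then $\exp(-A(\ln\nu+\nu^{1-1/k_\theta}))\rho_\theta^\nu\,\omega_{n,y}(m)\le\omega_{n,y}(\nu)$; (2) if $y\in V_{m,\theta}^\wedge$ with $1\le\theta\le s$, then $\omega_{n,y}(\nu)\le\exp(A(\ln\nu+\nu^{1-1/k_\theta}))\rho_\theta^\nu\,\omega_{n,y}(m)$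 and $(\omega_{n,\pi_\theta(y)}(m)-\alpha(\nu)\omega_{n,y}(m))\rho_\theta^\nu\exp(-A(\ln\nu+\nu^{1-1/k_\theta}))\le\omega_{n,y}(\nu)$; (3) if $k^\ast>0$ and $y\in V_{m,s+1}^\vee=V_{m,s+1}^\wedge$, then $|y(\nu)|\le(A/\nu)^{\nu/k^\ast}\omega_{n,y}(m)$. The spaces $V_{m,j}^\wedge$ do not depend on the choice of such a decomposition: $V_{m,j}^\wedge=\{y\in V_m:\limsup_{\nu\to\infty}|y(\nu)|^{1/\nu}\le\rho_j\}$. *)

theory Defs
  imports "HOL-Analysis.Analysis" "HOL-Library.Function_Algebras"
    "HOL-Library.Landau_Symbols" "HOL-Computational_Algebra.Computational_Algebra"
begin

text \<open>Addition on \<^typ>\<open>nat \<Rightarrow> complex\<close> is the pointwise one of \<^theory>\<open>HOL-Library.Function_Algebras\<close>.\<close>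

definition seq_scale :: "complex \<Rightarrow> (nat \<Rightarrow> complex) \<Rightarrow> nat \<Rightarrow> complex" where
  "seq_scale c y = (\<lambda>\<nu>. c * y \<nu>)"

global_interpretation seq: vector_space seq_scale
  by unfold_locales (auto simp: seq_scale_def fun_eq_iff algebra_simps)

text \<open>A sequence indexed by \<open>\<nu> \<ge> m\<close> is encoded as a function on all of \<^typ>\<open>nat\<close> vanishing below
  \<open>m\<close>, so that distinct functions are distinct sequences.\<close>

definition solution_space ::
    "nat \<Rightarrow> (nat \<Rightarrow> nat \<Rightarrow> complex) \<Rightarrow> nat \<Rightarrow> (nat \<Rightarrow> complex) set" where
  "solution_space n a m =
     {y. (\<forall>\<nu><m. y \<nu> = 0) \<and> (\<forall>\<nu>\<ge>m. (\<Sum>k\<le>n. a k \<nu> * y (\<nu> + k)) = 0)}"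

definition characteristic_poly :: "nat \<Rightarrow> (nat \<Rightarrow> complex) \<Rightarrow> complex poly" where
  "characteristic_poly n a = (\<Sum>k\<le>n. monom (a k) k)"

definition roots_of_abs :: "complex poly \<Rightarrow> real \<Rightarrow> complex set" where
  "roots_of_abs p r = {z. poly p z = 0 \<and> cmod z = r}"

definition mult_sum :: "complex poly \<Rightarrow> real \<Rightarrow> nat" where
  "mult_sum p r = (\<Sum>z\<in>roots_of_abs p r. order z p)"

definition mult_max :: "complex poly \<Rightarrow> real \<Rightarrow> nat" where
  "mult_max p r = Max (insert 0 ((\<lambda>z. order z p) ` roots_of_abs p r))"

definition omega :: "nat \<Rightarrow> (nat \<Rightarrow> complex) \<Rightarrow> nat \<Rightarrow> real" where
  "omega n y \<nu> = Max ((\<lambda>i. cmod (y (\<nu> + i))) ` {..<n})"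

definition sum_space :: "('i \<Rightarrow> (nat \<Rightarrow> complex) set) \<Rightarrow> 'i set \<Rightarrow> (nat \<Rightarrow> complex) set" where
  "sum_space W I = {\<Sum>i\<in>I. w i | w. \<forall>i\<in>I. w i \<in> W i}"

definition is_direct_sum ::
    "(nat \<Rightarrow> complex) set \<Rightarrow> ('i \<Rightarrow> (nat \<Rightarrow> complex) set) \<Rightarrow> 'i set \<Rightarrow> bool" where
  "is_direct_sum V W I \<longleftrightarrow>
     (\<forall>i\<in>I. seq.subspace (W i)) \<and> V = sum_space W I \<and>
     (\<forall>w. (\<forall>i\<in>I. w i \<in> W i) \<and> (\<Sum>i\<in>I. w i) = 0 \<longrightarrow> (\<forall>i\<in>I. w i = 0))"

text \<open>The projection of the direct sum of the \<open>W i\<close>, \<open>i \<in> I\<close>, onto \<open>W j\<close>; meaningful for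
  \<open>j \<in> I\<close> and \<open>y\<close> in a direct sum.\<close>

definition direct_sum_proj ::
    "('i \<Rightarrow> (nat \<Rightarrow> complex) set) \<Rightarrow> 'i set \<Rightarrow> 'i \<Rightarrow> (nat \<Rightarrow> complex) \<Rightarrow> nat \<Rightarrow> complex" where
  "direct_sum_proj W I j y =
     (THE v. \<exists>w. (\<forall>i\<in>I. w i \<in> W i) \<and> y = (\<Sum>i\<in>I. w i) \<and> v = w j)"

definition growth_exponent :: "nat \<Rightarrow> nat \<Rightarrow> real" where
  "growth_exponent k \<nu> = ln (real \<nu>) + real \<nu> powr (1 - 1 / real k)"

end

theory Submission imports Defs begin

text \<open>Write \<open>y = w\<^sub>1 + \<dots> + w\<^sub>\<theta>\<close> with \<open>w\<^sub>l\<close> in the \<open>l\<close>-th summand, and let \<open>g\<close> be the growth exponent for the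
  largest multiplicity. Up to factors \<open>exp (\<plusminus>O(g \<nu>))\<close> the component \<open>w\<^sub>l\<close> has size
  \<open>\<rho>\<^sub>l\<^sup>\<nu> \<omega>(w\<^sub>l)(m)\<close> at time \<open>\<nu>\<close>. If one component is much larger than the others at time \<open>\<nu>\<close>, the
  lower bound is immediate from the triangle inequality. The difficulty is a time \<open>\<nu>\<close> at which
  components of comparable size might cancel.

  The way out is to look into the future. If \<open>w\<^sub>i\<close> is not much smaller than the sum \<open>x\<close> of the
  components of slower growth, then after \<open>h = O(g \<nu>)\<close> further steps it exceeds \<open>x\<close>, since it
  gains at least a factor \<open>(\<rho>\<^sub>i / \<rho>\<^sub>i\<^sub>+\<^sub>1)\<^sup>h\<close> on it, up to factors as above; here \<open>g\<close> being
  sublinear ensures that \<open>g (\<nu> + h)\<close> is still of the order of \<open>g \<nu>\<close>. So \<open>\<omega>(w\<^sub>i + x)\<close> is large at time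
  \<open>\<nu> + h\<close>. But the recurrence, having bounded coefficients, lets a solution grow by at most a factor
  \<open>K\<close> per step, hence \<open>\<omega>(w\<^sub>i + x)\<close> was at least \<open>K\<^sup>-\<^sup>h\<close> times that value at time \<open>\<nu>\<close>, and the loss
  \<open>K\<^sup>h\<close> is again of the form \<open>exp (O(g \<nu>))\<close>. This is
  \<open>sum_lower_bound_despite_cancellation\<close>, a statement about real sequences.

  The components are added one at a time, from the slowest to the fastest
  (\<open>omega_component_sum_lower_bound\<close>). For the induction to close, the quantity bounded from below
  has to be the total size \<open>\<Sum>\<^sub>l \<rho>\<^sub>l\<^sup>\<nu> \<omega>(w\<^sub>l)(m)\<close>: up to such factors, it also bounds
  \<open>\<omega>(x)(\<nu>)\<close> from above, which its
  smallest exponential \<open>\<rho>\<^sub>\<theta>\<^sup>\<nu>\<close> alone would not do. The argument works for all large \<open>\<nu>\<close>; the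
  finitely many remaining \<open>\<nu>\<close> are compared with a single large time through the same factor \<open>K\<close>
  (\<open>lower_bound_on_initial_segment\<close>).\<close>

section \<open>The growth exponent\<close>

lemma growth_exponent_ge_1:
  assumes "k \<ge> 1" "\<nu> \<ge> 1"
  shows "growth_exponent k \<nu> \<ge> 1"
proof -
  have "ln (real \<nu>) \<ge> 0" "real \<nu> powr (1 - 1 / real k) \<ge> 1"
    using assms by (auto intro!: ge_one_powr_ge_zero)
  then show ?thesis by (simp add: growth_exponent_def)
qed

lemma growth_exponent_mono:
  assumes "k \<ge> 1" "k \<le> k'" "\<nu> \<ge> 1"
  shows "growth_exponent k \<nu> \<le> growth_exponent k' \<nu>"
proof -
  have "1 / real k' \<le> 1 / real k"
    using assms by (intro divide_left_mono) auto
  then show ?thesis using assms by (auto simp: growth_exponent_def intro!: powr_mono)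
qed

text \<open>For \<open>k \<ge> 2\<close> the bound fails at \<open>\<nu> = h = 1\<close>: the right-hand side is \<open>2\<close>, the left-hand side is at
  least \<open>ln 2 + sqrt 2\<close>.\<close>

lemma growth_exponent_add_le:
  assumes "k \<ge> 1" "\<nu> \<ge> 2" "h \<le> \<nu>"
  shows "growth_exponent k (\<nu> + h) \<le> 2 * growth_exponent k \<nu>"
proof -
  let ?c = "1 - 1 / real k"
  have c: "0 \<le> ?c" "?c \<le> 1" using assms(1) by auto
  have h: "real (\<nu> + h) \<le> 2 * real \<nu>" "real (\<nu> + h) > 0" "real \<nu> > 0" using assms by auto
  have "ln (real (\<nu> + h)) \<le> ln (2 * real \<nu>)" using h by (subst ln_le_cancel_iff) auto
  also have "\<dots> = ln 2 + ln (real \<nu>)" using h by (simp add: ln_mult)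
  also have "\<dots> \<le> 2 * ln (real \<nu>)" using assms by simp
  finally have 1: "ln (real (\<nu> + h)) \<le> 2 * ln (real \<nu>)" .
  have "real (\<nu> + h) powr ?c \<le> (2 * real \<nu>) powr ?c" using h c by (intro powr_mono2) auto
  also have "\<dots> = 2 powr ?c * real \<nu> powr ?c" by (simp add: powr_mult)
  also have "\<dots> \<le> 2 powr 1 * real \<nu> powr ?c" using c by (intro mult_right_mono powr_mono) auto
  finally show ?thesis using 1 by (simp add: growth_exponent_def)
qed

lemma growth_exponent_sublinear:
  assumes "k \<ge> 1"
  shows "(\<lambda>\<nu>. growth_exponent k \<nu> / real \<nu>) \<longlonglongrightarrow> 0"
proof -
  have "(\<lambda>\<nu>. real \<nu> powr (- 1 / real k)) \<longlonglongrightarrow> 0"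
    using assms by (intro tendsto_neg_powr filterlim_real_sequentially) auto
  then have "(\<lambda>\<nu>. ln (real \<nu>) / real \<nu> + real \<nu> powr (- 1 / real k)) \<longlonglongrightarrow> 0"
    using tendsto_add[OF lim_ln_over_n] by fastforce
  moreover have "\<forall>\<^sub>F \<nu> in sequentially. ln (real \<nu>) / real \<nu> + real \<nu> powr (- 1 / real k)
      = growth_exponent k \<nu> / real \<nu>"
    using eventually_gt_at_top[of 0]
    by eventually_elim (simp add: growth_exponent_def add_divide_distrib powr_diff powr_minus_divide)
  ultimately show ?thesis by (rule Lim_transform_eventually)
qed

section \<open>The seminorm \<open>omega\<close>\<close>

lemma omega_ge: "i < n \<Longrightarrow> cmod (y (\<nu> + i)) \<le> omega n y \<nu>"
  by (auto simp: omega_def intro!: Max_ge)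

lemma omega_leI:
  assumes "n \<ge> 1" "\<And>i. i < n \<Longrightarrow> cmod (y (\<nu> + i)) \<le> c"
  shows "omega n y \<nu> \<le> c"
  unfolding omega_def
proof (rule Max.boundedI)
  show "(\<lambda>i. cmod (y (\<nu> + i))) ` {..<n} \<noteq> {}" using assms(1) by (simp add: lessThan_empty_iff)
qed (use assms(2) in auto)

lemma omega_nonneg: "n \<ge> 1 \<Longrightarrow> 0 \<le> omega n y \<nu>"
  using omega_ge[of 0 n y \<nu>] by (simp add: order_trans[OF norm_ge_zero])

lemma omega_add_le:
  assumes "n \<ge> 1"
  shows "omega n (y + z) \<nu> \<le> omega n y \<nu> + omega n z \<nu>"
proof (rule omega_leI[OF assms])
  fix i assume "i < n"
  then show "cmod ((y + z) (\<nu> + i)) \<le> omega n y \<nu> + omega n z \<nu>"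
    using omega_ge[of i n y \<nu>] omega_ge[of i n z \<nu>]
      norm_triangle_ineq[of "y (\<nu> + i)" "z (\<nu> + i)"] by simp
qed

lemma omega_uminus: "omega n (- y) \<nu> = omega n y \<nu>"
  by (simp add: omega_def)

lemma omega_reverse_triangle:
  assumes "n \<ge> 1"
  shows "\<bar>omega n y \<nu> - omega n z \<nu>\<bar> \<le> omega n (y + z) \<nu>"
  using omega_add_le[OF assms, of "y + z" "- z" \<nu>] omega_add_le[OF assms, of "y + z" "- y" \<nu>]
  by (simp add: omega_uminus abs_le_iff)

lemma omega_sum_le:
  assumes "n \<ge> 1" "finite I"
  shows "omega n (\<Sum>i\<in>I. w i) \<nu> \<le> (\<Sum>i\<in>I. omega n (w i) \<nu>)"
  using assms(2)
proof (induction I rule: finite_induct)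
  case empty
  show ?case using assms(1) by (auto intro!: omega_leI)
next
  case (insert i I)
  show ?case
    unfolding sum.insert[OF insert.hyps]
    using omega_add_le[OF assms(1), of "w i" "\<Sum>i\<in>I. w i" \<nu>] insert.IH by linarith
qed

section \<open>Multiplicities, sum spaces and solution spaces\<close>

text \<open>A positive sum forces the set of roots to be finite, because sums over infinite sets are \<open>0\<close> by
  convention; so the maximum in \<open>mult_max\<close> is over a finite set.\<close>

lemma mult_max_pos:
  assumes "mult_sum p r > 0"
  shows "mult_max p r \<ge> 1"
proof -
  have fin: "finite (roots_of_abs p r)"
    using assms by (cases "finite (roots_of_abs p r)") (auto simp: mult_sum_def)
  obtain z where z: "z \<in> roots_of_abs p r" "order z p > 0"
    using assms unfolding mult_sum_def by (metis less_nat_zero_code neq0_conv sum.neutral)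
  then have "order z p \<le> mult_max p r"
    using fin by (auto simp: mult_max_def intro!: Max_ge)
  with z show ?thesis by simp
qed

lemma subspace_solution_space: "seq.subspace (solution_space n a m)"
proof -
  have "(\<Sum>k\<le>n. a k \<nu> * (c * y (\<nu> + k))) = c * (\<Sum>k\<le>n. a k \<nu> * y (\<nu> + k))" for c \<nu> y
    by (simp add: sum_distrib_left mult_ac)
  then show ?thesis
    by (auto simp: seq.subspace_def solution_space_def seq_scale_def sum.distrib distrib_left)
qed

lemma component_subset_sum_space:
  assumes "finite I" "i \<in> I" "\<And>l. l \<in> I \<Longrightarrow> 0 \<in> W l"
  shows "W i \<subseteq> sum_space W I"
proof
  fix y assume y: "y \<in> W i"
  define w where "w l = (if l = i then y else 0)" for l
  have "\<forall>l\<in>I. w l \<in> W l" using assms y by (auto simp: w_def)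
  moreover have "(\<Sum>l\<in>I. w l) = y" using assms by (simp add: w_def)
  ultimately show "y \<in> sum_space W I" unfolding sum_space_def by blast
qed

section \<open>Solutions grow at most geometrically\<close>

text \<open>Passing from \<open>\<nu>\<close> to \<open>Suc \<nu>\<close> brings just one new value, \<open>y (\<nu> + n)\<close>, into the window, and the
  recurrence expresses it through the \<open>n\<close> previous values.\<close>

lemma omega_Suc_le_of_bounded:
  assumes n: "n \<ge> 1" and lead: "\<And>\<nu>. a n \<nu> = 1"
    and B: "\<And>i \<nu>. i < n \<Longrightarrow> cmod (a i \<nu>) \<le> B"
    and y: "y \<in> solution_space n a m" and "\<nu> \<ge> m"
  shows "omega n y (Suc \<nu>) \<le> max 1 (real n * B) * omega n y \<nu>"
proof (rule omega_leI[OF n])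
  fix i assume i: "i < n"
  let ?K = "max 1 (real n * B)"
  have K: "omega n y \<nu> \<le> ?K * omega n y \<nu>"
    using mult_right_mono[of 1 ?K] omega_nonneg[OF n] by simp
  show "cmod (y (Suc \<nu> + i)) \<le> ?K * omega n y \<nu>"
  proof (cases "Suc i < n")
    case True
    then show ?thesis using omega_ge[of "Suc i" n y \<nu>] K by simp
  next
    case False
    then have "Suc i = n" using i by simp
    have "(\<Sum>k\<le>n. a k \<nu> * y (\<nu> + k)) = 0"
      using y \<open>\<nu> \<ge> m\<close> by (simp add: solution_space_def)
    then have "y (\<nu> + n) = - (\<Sum>k<n. a k \<nu> * y (\<nu> + k))"
      by (simp add: lead add_eq_0_iff flip: lessThan_Suc_atMost)
    then have "cmod (y (\<nu> + n)) \<le> (\<Sum>k<n. cmod (a k \<nu> * y (\<nu> + k)))"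
      by (simp add: norm_sum)
    also have "\<dots> \<le> (\<Sum>k<n. B * omega n y \<nu>)"
    proof (rule sum_mono)
      fix k assume "k \<in> {..<n}"
      then show "cmod (a k \<nu> * y (\<nu> + k)) \<le> B * omega n y \<nu>"
        unfolding norm_mult using B[of k \<nu>] omega_ge[of k n y \<nu>]
        by (intro mult_mono order_trans[OF norm_ge_zero]) auto
    qed
    also have "\<dots> = (real n * B) * omega n y \<nu>" by simp
    also have "\<dots> \<le> ?K * omega n y \<nu>" using omega_nonneg[OF n] by (intro mult_right_mono) auto
    finally have "cmod (y (\<nu> + n)) \<le> ?K * omega n y \<nu>" .
    moreover have "\<nu> + n = Suc \<nu> + i" using \<open>Suc i = n\<close> by simp
    ultimately show ?thesis by metis
  qed
qed

lemma bounded_of_bigo_inverse: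
  fixes f :: "nat \<Rightarrow> complex"
  assumes "(\<lambda>\<nu>. f \<nu> - c) \<in> O(\<lambda>\<nu>. 1 / of_nat (\<nu> + 1))"
  shows "\<exists>B. \<forall>\<nu>. cmod (f \<nu>) \<le> B"
proof -
  obtain C where C: "\<forall>\<^sub>F \<nu> in sequentially. cmod (f \<nu> - c) \<le> C * cmod (1 / of_nat (\<nu> + 1))"
    using assms by (elim landau_o.bigE)
  have "Bseq (\<lambda>\<nu>. f \<nu> - c)"
  proof (rule Bseq_eventually_mono)
    show "\<forall>\<^sub>F \<nu> in sequentially. norm (f \<nu> - c) \<le> norm (\<bar>C\<bar>)"
      using C
    proof eventually_elim
      case (elim \<nu>)
      note elim
      also have "C * cmod (1 / of_nat (\<nu> + 1)) \<le> \<bar>C\<bar> * 1"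
        by (intro mult_mono) (auto simp: norm_divide divide_simps simp del: of_nat_Suc)
      finally show ?case by simp
    qed
  qed simp
  then obtain K where "\<And>\<nu>. cmod (f \<nu> - c) \<le> K" by (auto simp: Bseq_def)
  then have "cmod (f \<nu>) \<le> K + cmod c" for \<nu>
    using norm_triangle_sub[of "f \<nu>" c] by (smt (verit))
  then show ?thesis by blast
qed

lemma iterated_growth_bound:
  fixes t :: "nat \<Rightarrow> real"
  assumes "K \<ge> 0" "\<And>\<nu>. \<nu> \<ge> m \<Longrightarrow> t (Suc \<nu>) \<le> K * t \<nu>" "\<nu> \<ge> m"
  shows "t (\<nu> + h) \<le> K ^ h * t \<nu>"
proof (induction h)
  case (Suc h)
  have "t (\<nu> + Suc h) \<le> K * t (\<nu> + h)" using assms by simp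
  also have "\<dots> \<le> K * (K ^ h * t \<nu>)" using Suc assms(1) by (intro mult_left_mono)
  finally show ?case by (simp add: mult_ac)
qed simp

lemma solution_omega_growth:
  assumes n: "n \<ge> 1" and lead: "\<And>\<nu>. a n \<nu> = 1"
    and coeffs: "\<And>i. i \<le> n \<Longrightarrow> (\<lambda>\<nu>. a i \<nu> - a_lim i) \<in> O(\<lambda>\<nu>. 1 / of_nat (\<nu> + 1))"
  obtains K where "K > 0"
    "\<And>y \<nu> h. y \<in> solution_space n a m \<Longrightarrow> \<nu> \<ge> m \<Longrightarrow> omega n y (\<nu> + h) \<le> K ^ h * omega n y \<nu>"
proof -
  have "\<forall>i. \<exists>B. i \<le> n \<longrightarrow> (\<forall>\<nu>. cmod (a i \<nu>) \<le> B)"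
    using bounded_of_bigo_inverse coeffs by metis
  then obtain b where b: "\<And>i \<nu>. i \<le> n \<Longrightarrow> cmod (a i \<nu>) \<le> b i" by metis
  define K where "K = max 1 (real n * Max (b ` {..n}))"
  have K: "K > 0" by (simp add: K_def)
  have rec: "omega n y (\<nu> + h) \<le> K ^ h * omega n y \<nu>" if y: "y \<in> solution_space n a m" and "\<nu> \<ge> m" for y \<nu> h
  proof (rule iterated_growth_bound[OF _ _ \<open>\<nu> \<ge> m\<close>])
    fix \<mu> assume "\<mu> \<ge> m"
    show "omega n y (Suc \<mu>) \<le> K * omega n y \<mu>"
      unfolding K_def
    proof (rule omega_Suc_le_of_bounded[OF n lead _ y \<open>\<mu> \<ge> m\<close>])
      fix i \<nu> assume "i < n"
      then have "b i \<le> Max (b ` {..n})" by (intro Max_ge) auto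
      then show "cmod (a i \<nu>) \<le> Max (b ` {..n})" using b[of i \<nu>] \<open>i < n\<close> by linarith
    qed
  qed (use K in simp)
  show thesis using that[OF K] rec by blast
qed

section \<open>Lower bounds that survive cancellation\<close>

text \<open>Here \<open>p\<close>, \<open>b\<close> and \<open>t\<close> stand for the sizes of a fast component, of the sum of the slower ones, and
  of their total, so that the reverse triangle inequality relates them. The numbers \<open>B'\<close> and \<open>N\<close> must not
  depend on the sequences: these vary with the solution under consideration.

  If \<open>S\<close> exceeds the size \<open>X\<close> of the fast component by a factor \<open>2 exp ((A + B) g \<nu>)\<close>, then \<open>b\<close>
  dominates at time \<open>\<nu>\<close>. Otherwise \<open>p\<close> dominates at time \<open>\<nu> + h\<close> for some \<open>h \<approx> C g \<nu>\<close>, and the bound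
  obtained there is carried back to \<open>\<nu>\<close> at the cost of the factor \<open>K\<^sup>h\<close>.\<close>

lemma sum_lower_bound_despite_cancellation:
  fixes g :: "nat \<Rightarrow> real"
  assumes g1: "\<And>\<nu>. \<nu> \<ge> N0 \<Longrightarrow> g \<nu> \<ge> 1"
    and g2: "\<And>\<nu> h. \<nu> \<ge> N0 \<Longrightarrow> h \<le> \<nu> \<Longrightarrow> g (\<nu> + h) \<le> 2 * g \<nu>"
    and g3: "(\<lambda>\<nu>. g \<nu> / real \<nu>) \<longlonglongrightarrow> 0"
    and A: "A \<ge> 0" and B: "B \<ge> 0" and K: "K > 0" and r: "0 < r" "r < \<sigma>"
  obtains B' N where "B' \<ge> 0" "N \<ge> N0"
    "\<And>P S p b t \<nu>. P \<ge> 0 \<Longrightarrow>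
      (\<And>\<nu>. \<nu> \<ge> N0 \<Longrightarrow> S \<nu> \<ge> 0) \<Longrightarrow>
      (\<And>\<nu>. \<nu> \<ge> N0 \<Longrightarrow> \<bar>p \<nu> - b \<nu>\<bar> \<le> t \<nu>) \<Longrightarrow>
      (\<And>\<nu>. \<nu> \<ge> N0 \<Longrightarrow> exp (- A * g \<nu>) * (P * \<sigma> ^ \<nu>) \<le> p \<nu>) \<Longrightarrow>
      (\<And>\<nu>. \<nu> \<ge> N0 \<Longrightarrow> p \<nu> \<le> exp (A * g \<nu>) * (P * \<sigma> ^ \<nu>)) \<Longrightarrow>
      (\<And>\<nu>. \<nu> \<ge> N0 \<Longrightarrow> exp (- B * g \<nu>) * S \<nu> \<le> b \<nu>) \<Longrightarrow>
      (\<And>\<nu>. \<nu> \<ge> N0 \<Longrightarrow> b \<nu> \<le> exp (A * g \<nu>) * S \<nu>) \<Longrightarrow>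
      (\<And>\<nu> h. \<nu> \<ge> N0 \<Longrightarrow> t (\<nu> + h) \<le> K ^ h * t \<nu>) \<Longrightarrow>
      (\<And>\<nu> h. \<nu> \<ge> N0 \<Longrightarrow> S (\<nu> + h) \<le> r ^ h * S \<nu>) \<Longrightarrow>
      \<nu> \<ge> N \<Longrightarrow> exp (- B' * g \<nu>) * (P * \<sigma> ^ \<nu> + S \<nu>) \<le> t \<nu>"
proof -
  have e2: "4 \<le> exp (2::real)"
    using mult_mono[of 2 "exp 1" 2 "exp (1::real)"] exp_ge_add_one_self[of 1]
    by (simp flip: exp_add)
  then have e3: "8 \<le> exp (3::real)"
    using mult_mono[of 2 "exp 1" 4 "exp (2::real)"] exp_ge_add_one_self[of 1]
    by (simp flip: exp_add)
  \<comment> \<open>Overtaking must beat \<open>4 exp ((5 A + B) g \<nu>)\<close>: \<open>A + B\<close> is the possible deficit at time \<open>\<nu>\<close>,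
    and the bounds on \<open>p\<close> and \<open>b\<close> at time \<open>\<nu> + h\<close> cost \<open>2 A\<close> each as \<open>g (\<nu> + h) \<le> 2 g \<nu>\<close>; the
    summand \<open>2\<close> pays for the factor \<open>4\<close>. The number \<open>L\<close> measures the loss per step in going back.\<close>
  define C where "C = (5 * A + B + 2) / ln (\<sigma> / r)"
  define L where "L = \<bar>ln (K / \<sigma>)\<bar>"
  define B' where "B' = 3 * A + B + 3 + (C + 1) * L"
  have lnq: "ln (\<sigma> / r) > 0" using r by simp
  have C: "C \<ge> 0" using A B lnq by (simp add: C_def)
  have L: "L \<ge> 0" by (simp add: L_def)
  have B': "B' \<ge> 0" using A B C L by (simp add: B'_def)
  have "\<forall>\<^sub>F \<nu> in sequentially. g \<nu> / real \<nu> < 1 / (C + 1)"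
    using order_tendstoD(2)[OF g3, of "1 / (C + 1)"] C by simp
  then obtain N1 where N1: "\<And>\<nu>. \<nu> \<ge> N1 \<Longrightarrow> g \<nu> / real \<nu> < 1 / (C + 1)"
    by (auto simp: eventually_sequentially)
  define N where "N = max 1 (max N0 N1)"
  show thesis
  proof (rule that[OF B', of N])
    show "N \<ge> N0" by (simp add: N_def)
    fix P :: real and S p b t :: "nat \<Rightarrow> real" and \<nu>
    assume P: "P \<ge> 0" and \<nu>: "\<nu> \<ge> N"
      and S_nonneg: "\<And>\<nu>. \<nu> \<ge> N0 \<Longrightarrow> S \<nu> \<ge> 0"
      and t_ge: "\<And>\<nu>. \<nu> \<ge> N0 \<Longrightarrow> \<bar>p \<nu> - b \<nu>\<bar> \<le> t \<nu>"
      and p_ge: "\<And>\<nu>. \<nu> \<ge> N0 \<Longrightarrow> exp (- A * g \<nu>) * (P * \<sigma> ^ \<nu>) \<le> p \<nu>"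
      and p_le: "\<And>\<nu>. \<nu> \<ge> N0 \<Longrightarrow> p \<nu> \<le> exp (A * g \<nu>) * (P * \<sigma> ^ \<nu>)"
      and b_ge: "\<And>\<nu>. \<nu> \<ge> N0 \<Longrightarrow> exp (- B * g \<nu>) * S \<nu> \<le> b \<nu>"
      and b_le: "\<And>\<nu>. \<nu> \<ge> N0 \<Longrightarrow> b \<nu> \<le> exp (A * g \<nu>) * S \<nu>"
      and t_add: "\<And>\<nu> h. \<nu> \<ge> N0 \<Longrightarrow> t (\<nu> + h) \<le> K ^ h * t \<nu>"
      and S_add: "\<And>\<nu> h. \<nu> \<ge> N0 \<Longrightarrow> S (\<nu> + h) \<le> r ^ h * S \<nu>"
    have \<nu>0: "\<nu> \<ge> N0" "\<nu> \<ge> N1" "\<nu> \<ge> 1" using \<nu> by (auto simp: N_def)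
    define X where "X = P * \<sigma> ^ \<nu>"
    have X: "X \<ge> 0" using P r by (simp add: X_def)
    have S: "S \<nu> \<ge> 0" using S_nonneg \<nu>0 by simp
    have g: "g \<nu> \<ge> 1" using g1 \<nu>0 by simp
    \<comment> \<open>Constant factors up to \<open>exp 3\<close> disappear into the exponent because \<open>g \<nu> \<ge> 1\<close>.\<close>
    have absorb: "c * exp (- B' * g \<nu>) \<le> exp (- D * g \<nu>)"
      if "c \<le> exp 3" "D + 3 \<le> B'" for c D
    proof -
      have "c * exp (- B' * g \<nu>) \<le> exp 3 * exp (- B' * g \<nu>)" using that by simp
      also have "\<dots> = exp (3 - B' * g \<nu>)" by (simp flip: exp_add)
      also have "\<dots> \<le> exp (- D * g \<nu>)"
      proof -
        have "3 * 1 \<le> (B' - D) * g \<nu>" using that g by (intro mult_mono) auto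
        then show ?thesis by (simp add: algebra_simps)
      qed
      finally show ?thesis .
    qed
    show "exp (- B' * g \<nu>) * (P * \<sigma> ^ \<nu> + S \<nu>) \<le> t \<nu>"
    proof (cases "exp (A * g \<nu>) * X \<le> exp (- B * g \<nu>) * S \<nu> / 2")
      case True
      have "1 * X \<le> exp (A * g \<nu>) * X" using A g X by (intro mult_right_mono) auto
      also note True
      also have "exp (- B * g \<nu>) * S \<nu> / 2 \<le> 1 * S \<nu> / 2"
        using B g S by (intro divide_right_mono mult_right_mono) auto
      finally have "X \<le> S \<nu>" using S by simp
      then have "exp (- B' * g \<nu>) * (X + S \<nu>) \<le> exp (- B' * g \<nu>) * (2 * S \<nu>)"
        by (intro mult_left_mono) auto
      also have "\<dots> = (4 * exp (- B' * g \<nu>)) * S \<nu> / 2" by simp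
      also have "\<dots> \<le> exp (- B * g \<nu>) * S \<nu> / 2"
        using absorb[of 4 B] e3 A C L S by (intro divide_right_mono mult_right_mono) (auto simp: B'_def)
      also have "\<dots> \<le> exp (- B * g \<nu>) * S \<nu> - exp (A * g \<nu>) * X" using True by linarith
      also have "\<dots> \<le> t \<nu>" using t_ge[OF \<nu>0(1)] p_le[OF \<nu>0(1)] b_ge[OF \<nu>0(1)] by (simp add: X_def abs_le_iff)
      finally show ?thesis by (simp add: X_def)
    next
      case False
      \<comment> \<open>The number of steps after which the fast component has overtaken the slower ones.\<close>
      define h where "h = nat \<lceil>C * g \<nu>\<rceil>"
      have h: "C * g \<nu> \<le> real h" "real h \<le> (C + 1) * g \<nu>"
      proof -
        have "C * g \<nu> \<ge> 0" using C g by simp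
        then show "C * g \<nu> \<le> real h" "real h \<le> (C + 1) * g \<nu>"
          using g ceiling_correct[of "C * g \<nu>"] by (auto simp: h_def algebra_simps)
      qed
      have "(C + 1) * g \<nu> \<le> real \<nu>" using N1[OF \<nu>0(2)] C \<nu>0(3) by (simp add: field_simps)
      then have "h \<le> \<nu>" using h by simp
      then have g\<mu>: "g (\<nu> + h) \<le> 2 * g \<nu>" using g2 \<nu>0 by simp
      have \<mu>0: "\<nu> + h \<ge> N0" using \<nu>0 by simp
      have S_le: "S \<nu> \<le> 2 * exp ((A + B) * g \<nu>) * X"
      proof -
        have "exp (B * g \<nu>) * (exp (- B * g \<nu>) * S \<nu>) \<le> exp (B * g \<nu>) * (2 * (exp (A * g \<nu>) * X))"
          using False by (intro mult_left_mono) auto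
        moreover have "exp (B * g \<nu>) * (exp (- B * g \<nu>) * S \<nu>) = S \<nu>"
          by (simp add: exp_minus)
        moreover have "exp (B * g \<nu>) * (2 * (exp (A * g \<nu>) * X)) = 2 * exp ((A + B) * g \<nu>) * X"
          unfolding distrib_right exp_add by (simp only: mult_ac)
        ultimately show ?thesis by linarith
      qed
      have pow: "x ^ h = exp (real h * ln x)" if "x > 0" for x
        using that by (simp add: exp_of_nat_mult)
      have "4 * exp ((5 * A + B) * g \<nu>) \<le> exp (2 * g \<nu>) * exp ((5 * A + B) * g \<nu>)"
      proof -
        have "exp 2 \<le> exp (2 * g \<nu>)" using g by simp
        with e2 have "4 \<le> exp (2 * g \<nu>)" by linarith
        then show ?thesis by (intro mult_right_mono) auto
      qed
      also have "\<dots> = exp (C * g \<nu> * ln (\<sigma> / r))"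
      proof -
        have "C * ln (\<sigma> / r) = 5 * A + B + 2" using lnq by (simp add: C_def)
        then have "C * g \<nu> * ln (\<sigma> / r) = (5 * A + B + 2) * g \<nu>" by (metis mult.assoc mult.commute)
        then show ?thesis by (simp add: algebra_simps flip: exp_add)
      qed
      also have "\<dots> \<le> exp (real h * ln (\<sigma> / r))" using h lnq by simp
      also have "\<dots> = (\<sigma> / r) ^ h" using r by (subst pow) auto
      finally have ratio: "4 * exp ((5 * A + B) * g \<nu>) * r ^ h \<le> \<sigma> ^ h"
        using r by (simp add: power_divide pos_le_divide_eq)
      have expA: "exp (A * g (\<nu> + h)) \<le> exp (2 * A * g \<nu>)"
        using mult_left_mono[OF g\<mu> A] by (simp add: mult_ac)
      then have expA': "exp (- 2 * A * g \<nu>) \<le> exp (- A * g (\<nu> + h))" by simp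
      have "b (\<nu> + h) \<le> exp (A * g (\<nu> + h)) * S (\<nu> + h)" by (rule b_le[OF \<mu>0])
      also have "\<dots> \<le> exp (2 * A * g \<nu>) * (r ^ h * (2 * exp ((A + B) * g \<nu>) * X))"
      proof (rule mult_mono[OF expA])
        have "S (\<nu> + h) \<le> r ^ h * S \<nu>" by (rule S_add[OF \<nu>0(1)])
        also have "\<dots> \<le> r ^ h * (2 * exp ((A + B) * g \<nu>) * X)"
          using r by (intro mult_left_mono S_le) auto
        finally show "S (\<nu> + h) \<le> r ^ h * (2 * exp ((A + B) * g \<nu>) * X)" .
      qed (use S_nonneg[OF \<mu>0] in auto)
      also have "\<dots> = (exp (2 * A * g \<nu>) * exp ((A + B) * g \<nu>)) * (2 * r ^ h * X)"
        by (simp only: mult_ac)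
      also have "exp (2 * A * g \<nu>) * exp ((A + B) * g \<nu>)
          = exp (- 2 * A * g \<nu>) * exp ((5 * A + B) * g \<nu>)"
        by (simp add: algebra_simps flip: exp_add)
      also have "\<dots> * (2 * r ^ h * X)
          = exp (- 2 * A * g \<nu>) * (4 * exp ((5 * A + B) * g \<nu>) * r ^ h) * X / 2"
        by simp
      also have "\<dots> \<le> exp (- 2 * A * g \<nu>) * \<sigma> ^ h * X / 2"
        using X by (intro divide_right_mono mult_right_mono mult_left_mono ratio) auto
      finally have b: "b (\<nu> + h) \<le> exp (- 2 * A * g \<nu>) * \<sigma> ^ h * X / 2" .
      have "exp (- 2 * A * g \<nu>) * (\<sigma> ^ h * X) \<le> exp (- A * g (\<nu> + h)) * (\<sigma> ^ h * X)"
        using X r by (intro mult_right_mono expA') auto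
      also have "\<dots> \<le> p (\<nu> + h)" using p_ge[OF \<mu>0] by (simp add: X_def power_add mult_ac)
      finally have p: "exp (- 2 * A * g \<nu>) * \<sigma> ^ h * X \<le> p (\<nu> + h)" by (simp add: mult_ac)
      have "exp (- 2 * A * g \<nu>) * \<sigma> ^ h * X / 2 \<le> t (\<nu> + h)"
        using b p t_ge[OF \<mu>0] by (simp add: abs_le_iff)
      also have "\<dots> \<le> K ^ h * t \<nu>" by (rule t_add[OF \<nu>0(1)])
      finally have "exp (- 2 * A * g \<nu>) * (\<sigma> / K) ^ h * X / 2 \<le> t \<nu>"
        using K by (simp add: power_divide pos_divide_le_eq mult_ac)
      moreover have "exp (- ((C + 1) * L) * g \<nu>) \<le> (\<sigma> / K) ^ h"
      proof -
        have "real h * - ln (\<sigma> / K) \<le> real h * L"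
          using K r by (intro mult_left_mono) (auto simp: L_def ln_div)
        also have "\<dots> \<le> (C + 1) * g \<nu> * L" using h L by (intro mult_right_mono)
        finally show ?thesis using K r by (subst pow) (auto simp: mult_ac)
      qed
      ultimately have t: "exp (- 2 * A * g \<nu>) * exp (- ((C + 1) * L) * g \<nu>) * X / 2 \<le> t \<nu>"
        using X by (meson divide_right_mono exp_ge_zero mult_left_mono mult_right_mono order_trans zero_le_numeral)
      have "X + S \<nu> \<le> 3 * exp ((A + B) * g \<nu>) * X"
      proof -
        have "1 * X \<le> exp ((A + B) * g \<nu>) * X" using A B g X by (intro mult_right_mono) auto
        then show ?thesis using S_le by simp
      qed
      then have "exp (- B' * g \<nu>) * (X + S \<nu>) \<le> exp (- B' * g \<nu>) * (3 * exp ((A + B) * g \<nu>) * X)"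
        by (intro mult_left_mono) auto
      also have "\<dots> = 6 * exp (- B' * g \<nu>) * exp ((A + B) * g \<nu>) * X / 2" by simp
      also have "\<dots> \<le> exp (- (B' - 3) * g \<nu>) * exp ((A + B) * g \<nu>) * X / 2"
        using absorb[of 6 "B' - 3"] e3 X by (intro divide_right_mono mult_right_mono) auto
      also have "\<dots> = exp (- 2 * A * g \<nu>) * exp (- ((C + 1) * L) * g \<nu>) * X / 2"
        by (simp add: B'_def algebra_simps flip: exp_add)
      also note t
      finally show ?thesis by (simp add: X_def)
    qed
  qed
qed

text \<open>For \<open>\<nu> < N\<close> the sequence \<open>t\<close> has to reach its lower bound at \<open>N\<close> within \<open>N - \<nu> \<le> N\<close> steps, so it
  cannot be too small at \<open>\<nu>\<close>. The total loss is bounded by a constant, which \<open>g \<ge> 1\<close> moves into the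
  exponent.\<close>

lemma lower_bound_on_initial_segment:
  fixes g :: "nat \<Rightarrow> real"
  assumes g_ge1: "\<And>\<nu>. \<nu> \<ge> m \<Longrightarrow> g \<nu> \<ge> 1"
    and c: "c > 0" and K: "K > 0" and B: "B \<ge> 0" and N: "N \<ge> m"
  obtains A' where "A' > 0"
    "\<And>t Y \<nu>. Y \<ge> 0 \<Longrightarrow>
      (\<And>\<nu> h. \<nu> \<ge> m \<Longrightarrow> t (\<nu> + h) \<le> K ^ h * t \<nu>) \<Longrightarrow>
      (\<And>\<nu>. \<nu> \<ge> N \<Longrightarrow> exp (- B * g \<nu>) * (c ^ \<nu> * Y) \<le> t \<nu>) \<Longrightarrow>
      \<nu> \<ge> m \<Longrightarrow> exp (- A' * g \<nu>) * (c ^ \<nu> * Y) \<le> t \<nu>"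
proof -
  define L where "L = \<bar>ln (c / K)\<bar>"
  define A' where "A' = B * g N + real N * L + B + 1"
  have L: "L \<ge> 0" by (simp add: L_def)
  have A': "A' > 0" "A' \<ge> B" using B g_ge1[OF N] L by (auto simp: A'_def add_nonneg_pos)
  show thesis
  proof (rule that[OF A'(1)])
    fix t :: "nat \<Rightarrow> real" and Y :: real and \<nu>
    assume Y: "Y \<ge> 0" and rec: "\<And>\<nu> h. \<nu> \<ge> m \<Longrightarrow> t (\<nu> + h) \<le> K ^ h * t \<nu>"
      and late: "\<And>\<nu>. \<nu> \<ge> N \<Longrightarrow> exp (- B * g \<nu>) * (c ^ \<nu> * Y) \<le> t \<nu>" and \<nu>: "\<nu> \<ge> m"
    have g\<nu>: "g \<nu> \<ge> 1" using g_ge1 \<nu> by simp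
    show "exp (- A' * g \<nu>) * (c ^ \<nu> * Y) \<le> t \<nu>"
    proof (cases "\<nu> \<ge> N")
      case True
      have "exp (- A' * g \<nu>) * (c ^ \<nu> * Y) \<le> exp (- B * g \<nu>) * (c ^ \<nu> * Y)"
        using A'(2) g\<nu> c Y by (intro mult_right_mono) auto
      then show ?thesis using late[OF True] by linarith
    next
      case False
      define h where "h = N - \<nu>"
      have Nh: "N = \<nu> + h" using False by (simp add: h_def)
      have "exp (- B * g N) * (c ^ N * Y) \<le> K ^ h * t \<nu>"
        using late[OF order_refl] rec[OF \<nu>, of h] by (simp add: Nh)
      then have from_N: "exp (- B * g N) * (c / K) ^ h * (c ^ \<nu> * Y) \<le> t \<nu>"
        using K by (simp add: Nh power_add power_divide pos_divide_le_eq mult_ac)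
      have "exp (- A' * g \<nu>) \<le> exp (- A')" using A'(1) g\<nu> by simp
      also have "\<dots> \<le> exp (- B * g N + real h * ln (c / K))"
      proof -
        have "real h * - ln (c / K) \<le> real h * L" by (intro mult_left_mono) (auto simp: L_def)
        also have "\<dots> \<le> real N * L" using L by (intro mult_right_mono) (auto simp: h_def)
        finally show ?thesis using B by (simp add: A'_def)
      qed
      also have "\<dots> = exp (- B * g N) * (c / K) ^ h"
        using c K unfolding exp_add by (simp add: exp_of_nat_mult)
      finally have "exp (- A' * g \<nu>) * (c ^ \<nu> * Y) \<le> exp (- B * g N) * (c / K) ^ h * (c ^ \<nu> * Y)"
        using c Y by (intro mult_right_mono) auto
      then show ?thesis using from_N by linarith
    qed
  qed
qed

text \<open>The induction runs downwards from \<open>i = \<theta>\<close>, adding components of increasing growth. In the step,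
  \<open>sum_lower_bound_despite_cancellation\<close> is applied with the rates \<open>\<rho> i > \<rho> (Suc i)\<close>: every summand of
  the total size of the later components gains at most a factor \<open>\<rho> (Suc i)\<close> per step.\<close>

lemma omega_component_sum_lower_bound:
  fixes W :: "nat \<Rightarrow> (nat \<Rightarrow> complex) set" and \<rho> g :: "nat \<Rightarrow> real" and n m \<theta> :: nat
  defines "Y \<equiv> \<lambda>w. omega n w m"
  assumes n: "n \<ge> 1"
    and g_ge1: "\<And>\<nu>. \<nu> \<ge> 1 \<Longrightarrow> g \<nu> \<ge> 1"
    and g_double: "\<And>\<nu> h. \<nu> \<ge> 2 \<Longrightarrow> h \<le> \<nu> \<Longrightarrow> g (\<nu> + h) \<le> 2 * g \<nu>"
    and g_sub: "(\<lambda>\<nu>. g \<nu> / real \<nu>) \<longlonglongrightarrow> 0"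
    and A: "A \<ge> 0" and K: "K > 0"
    and \<rho>_pos: "\<And>l. l \<in> {1..\<theta>} \<Longrightarrow> \<rho> l > 0"
    and \<rho>_decr: "\<And>l. l \<in> {1..<\<theta>} \<Longrightarrow> \<rho> (Suc l) < \<rho> l"
    and lo: "\<And>l y \<nu>. l \<in> {1..\<theta>} \<Longrightarrow> y \<in> W l \<Longrightarrow> \<nu> \<ge> m \<Longrightarrow>
      exp (- A * g \<nu>) * (Y y * \<rho> l ^ \<nu>) \<le> omega n y \<nu>"
    and up: "\<And>l y \<nu>. l \<in> {1..\<theta>} \<Longrightarrow> y \<in> W l \<Longrightarrow> \<nu> \<ge> m \<Longrightarrow>
      omega n y \<nu> \<le> exp (A * g \<nu>) * (Y y * \<rho> l ^ \<nu>)"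
    and rec: "\<And>i w \<nu> h. 1 \<le> i \<Longrightarrow> \<forall>l\<in>{i..\<theta>}. w l \<in> W l \<Longrightarrow> \<nu> \<ge> m \<Longrightarrow>
      omega n (\<Sum>l\<in>{i..\<theta>}. w l) (\<nu> + h) \<le> K ^ h * omega n (\<Sum>l\<in>{i..\<theta>}. w l) \<nu>"
    and i: "1 \<le> i" "i \<le> \<theta>"
  shows "\<exists>B\<ge>0. \<exists>N\<ge>m. \<forall>w. (\<forall>l\<in>{i..\<theta>}. w l \<in> W l) \<longrightarrow> (\<forall>\<nu>\<ge>N.
    exp (- B * g \<nu>) * (\<Sum>l\<in>{i..\<theta>}. Y (w l) * \<rho> l ^ \<nu>) \<le> omega n (\<Sum>l\<in>{i..\<theta>}. w l) \<nu>)"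
  using i(2,1)
proof (induction i rule: inc_induct)
  case base
  show ?case
  proof (rule exI[of _ A], intro conjI exI[of _ m] allI impI)
    fix w \<nu> assume "\<forall>l\<in>{\<theta>..\<theta>}. w l \<in> W l" "m \<le> \<nu>"
    then show "exp (- A * g \<nu>) * (\<Sum>l\<in>{\<theta>..\<theta>}. Y (w l) * \<rho> l ^ \<nu>) \<le> omega n (\<Sum>l\<in>{\<theta>..\<theta>}. w l) \<nu>"
      using lo[of \<theta> "w \<theta>" \<nu>] base by simp
  qed (use A in auto)
next
  case (step i)
  have Y_nonneg: "Y w \<ge> 0" for w using omega_nonneg[OF n] by (simp add: Y_def)
  have \<rho>_le: "\<rho> j \<le> \<rho> l" if "1 \<le> l" "l \<le> j" "j \<le> \<theta>" for l j
    using that(2,3)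
  proof (induction j rule: dec_induct)
    case (step j)
    then show ?case using \<rho>_decr[of j] that(1) by simp
  qed simp
  from step.IH[OF le_SucI[OF step.prems]] obtain B N where B: "B \<ge> 0" and N: "N \<ge> m"
    and IH: "\<And>w \<nu>. \<forall>l\<in>{Suc i..\<theta>}. w l \<in> W l \<Longrightarrow> \<nu> \<ge> N \<Longrightarrow>
      exp (- B * g \<nu>) * (\<Sum>l\<in>{Suc i..\<theta>}. Y (w l) * \<rho> l ^ \<nu>) \<le> omega n (\<Sum>l\<in>{Suc i..\<theta>}. w l) \<nu>"
    by blast
  have i: "i \<in> {1..\<theta>}" "Suc i \<in> {1..\<theta>}" "i \<in> {1..<\<theta>}" using step by auto
  \<comment> \<open>At least \<open>2\<close>, so that \<open>g_double\<close> is available.\<close>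
  define N0 where "N0 = max 2 N"
  have N0: "N0 \<ge> m" "N0 \<ge> N" "N0 \<ge> 2" using N by (auto simp: N0_def)
  have g_add: "g (\<nu> + h) \<le> 2 * g \<nu>" if "\<nu> \<ge> N0" "h \<le> \<nu>" for \<nu> h
    using g_double that N0 by simp
  have g1: "1 \<le> g \<nu>" if "\<nu> \<ge> N0" for \<nu> using g_ge1 that N0 by simp
  obtain B' N' where B': "B' \<ge> 0" and N': "N' \<ge> N0" and
    D: "\<And>P S p b t \<nu>. P \<ge> 0 \<Longrightarrow>
      (\<And>\<nu>. \<nu> \<ge> N0 \<Longrightarrow> S \<nu> \<ge> 0) \<Longrightarrow>
      (\<And>\<nu>. \<nu> \<ge> N0 \<Longrightarrow> \<bar>p \<nu> - b \<nu>\<bar> \<le> t \<nu>) \<Longrightarrow>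
      (\<And>\<nu>. \<nu> \<ge> N0 \<Longrightarrow> exp (- A * g \<nu>) * (P * \<rho> i ^ \<nu>) \<le> p \<nu>) \<Longrightarrow>
      (\<And>\<nu>. \<nu> \<ge> N0 \<Longrightarrow> p \<nu> \<le> exp (A * g \<nu>) * (P * \<rho> i ^ \<nu>)) \<Longrightarrow>
      (\<And>\<nu>. \<nu> \<ge> N0 \<Longrightarrow> exp (- B * g \<nu>) * S \<nu> \<le> b \<nu>) \<Longrightarrow>
      (\<And>\<nu>. \<nu> \<ge> N0 \<Longrightarrow> b \<nu> \<le> exp (A * g \<nu>) * S \<nu>) \<Longrightarrow>
      (\<And>\<nu> h. \<nu> \<ge> N0 \<Longrightarrow> t (\<nu> + h) \<le> K ^ h * t \<nu>) \<Longrightarrow>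
      (\<And>\<nu> h. \<nu> \<ge> N0 \<Longrightarrow> S (\<nu> + h) \<le> \<rho> (Suc i) ^ h * S \<nu>) \<Longrightarrow>
      \<nu> \<ge> N' \<Longrightarrow> exp (- B' * g \<nu>) * (P * \<rho> i ^ \<nu> + S \<nu>) \<le> t \<nu>"
    by (rule sum_lower_bound_despite_cancellation[OF g1 g_add g_sub A B K \<rho>_pos[OF i(2)] \<rho>_decr[OF i(3)]]) blast+
  show ?case
  proof (rule exI[of _ B'], intro conjI B' exI[of _ N'] allI impI)
    show "N' \<ge> m" using N' N0 by simp
    fix w \<nu> assume w: "\<forall>l\<in>{i..\<theta>}. w l \<in> W l" and \<nu>: "\<nu> \<ge> N'"
    define S where "S \<mu> = (\<Sum>l\<in>{Suc i..\<theta>}. Y (w l) * \<rho> l ^ \<mu>)" for \<mu>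
    define x where "x = (\<Sum>l\<in>{Suc i..\<theta>}. w l)"
    have split: "{i..\<theta>} = insert i {Suc i..\<theta>}" using step by auto
    have sum_x: "(\<Sum>l\<in>{i..\<theta>}. w l) = w i + x"
      unfolding x_def split by (subst sum.insert) auto
    have later: "l \<in> {1..\<theta>}" "\<rho> l > 0" "w l \<in> W l" if "l \<in> {Suc i..\<theta>}" for l
      using that step w \<rho>_pos[of l] by auto
    have "exp (- B' * g \<nu>) * (Y (w i) * \<rho> i ^ \<nu> + S \<nu>) \<le> omega n (w i + x) \<nu>"
    proof (rule D[OF Y_nonneg _ _ _ _ _ _ _ _ \<nu>, of S "omega n (w i)" "omega n x"])
      fix \<mu> assume "\<mu> \<ge> N0"
      then have \<mu>: "\<mu> \<ge> m" "\<mu> \<ge> N" using N0 by auto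
      show "S \<mu> \<ge> 0"
        unfolding S_def using later(2) Y_nonneg by (intro sum_nonneg mult_nonneg_nonneg) (auto intro: less_imp_le)
      show "\<bar>omega n (w i) \<mu> - omega n x \<mu>\<bar> \<le> omega n (w i + x) \<mu>"
        by (rule omega_reverse_triangle[OF n])
      show "exp (- A * g \<mu>) * (Y (w i) * \<rho> i ^ \<mu>) \<le> omega n (w i) \<mu>"
        using lo i w step \<mu> by simp
      show "omega n (w i) \<mu> \<le> exp (A * g \<mu>) * (Y (w i) * \<rho> i ^ \<mu>)"
        using up i w step \<mu> by simp
      show "exp (- B * g \<mu>) * S \<mu> \<le> omega n x \<mu>"
        unfolding S_def x_def using IH w \<mu> by simp
      have "omega n x \<mu> \<le> (\<Sum>l\<in>{Suc i..\<theta>}. omega n (w l) \<mu>)"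
        unfolding x_def by (intro omega_sum_le n) auto
      also have "\<dots> \<le> exp (A * g \<mu>) * S \<mu>"
        unfolding S_def sum_distrib_left using up later \<mu> by (intro sum_mono) auto
      finally show "omega n x \<mu> \<le> exp (A * g \<mu>) * S \<mu>" .
      fix h
      show "omega n (w i + x) (\<mu> + h) \<le> K ^ h * omega n (w i + x) \<mu>"
        using rec[OF step.prems w \<mu>(1)] by (simp only: sum_x)
      show "S (\<mu> + h) \<le> \<rho> (Suc i) ^ h * S \<mu>"
        unfolding S_def sum_distrib_left
      proof (rule sum_mono)
        fix l assume l: "l \<in> {Suc i..\<theta>}"
        have "\<rho> l ^ h \<le> \<rho> (Suc i) ^ h"
          using \<rho>_le[of "Suc i" l] l later[OF l] step.prems by (intro power_mono) auto
        then have "\<rho> l ^ h * (Y (w l) * \<rho> l ^ \<mu>) \<le> \<rho> (Suc i) ^ h * (Y (w l) * \<rho> l ^ \<mu>)"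
          using later[OF l] Y_nonneg by (intro mult_right_mono) auto
        then show "Y (w l) * \<rho> l ^ (\<mu> + h) \<le> \<rho> (Suc i) ^ h * (Y (w l) * \<rho> l ^ \<mu>)"
          by (simp add: power_add mult_ac)
      qed
    qed
    moreover have "(\<Sum>l\<in>{i..\<theta>}. Y (w l) * \<rho> l ^ \<nu>) = Y (w i) * \<rho> i ^ \<nu> + S \<nu>"
      unfolding S_def split by (subst sum.insert) auto
    ultimately show "exp (- B' * g \<nu>) * (\<Sum>l\<in>{i..\<theta>}. Y (w l) * \<rho> l ^ \<nu>) \<le> omega n (\<Sum>l\<in>{i..\<theta>}. w l) \<nu>"
      by (simp only: sum_x)
  qed
qed

section \<open>The lower bound on sums of the first summands\<close>

theorem theorem8:
  fixes s n m \<theta> :: nat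
    and a :: "nat \<Rightarrow> nat \<Rightarrow> complex" and a_lim :: "nat \<Rightarrow> complex"
    and \<rho> :: "nat \<Rightarrow> real" and e k :: "nat \<Rightarrow> nat"
    and T :: "complex poly"
    and A :: real and \<alpha> :: "nat \<Rightarrow> real"
    and Vv Vw Vs :: "nat \<Rightarrow> (nat \<Rightarrow> complex) set"
  defines "T \<equiv> characteristic_poly n a_lim"
    and "e \<equiv> \<lambda>i. mult_sum T (\<rho> i)"
    and "k \<equiv> \<lambda>i. mult_max T (\<rho> i)"
    and "Vw \<equiv> \<lambda>j. sum_space Vv {j..s+1}"
    and "Vs \<equiv> \<lambda>j. sum_space Vv {1..j}"
  assumes n: "n \<ge> 1"
    and lead: "\<And>\<nu>. a n \<nu> = 1"
    and coeffs: "\<And>i. i \<le> n \<Longrightarrow> (\<lambda>\<nu>. a i \<nu> - a_lim i) \<in> O(\<lambda>\<nu>. 1 / of_nat (\<nu> + 1))"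
    and \<rho>_decr: "\<And>i. 1 \<le> i \<Longrightarrow> i \<le> s \<Longrightarrow> \<rho> i > \<rho> (i + 1)"
    and \<rho>_last: "\<rho> (s + 1) = 0"
    and roots: "\<And>z. poly T z = 0 \<Longrightarrow> \<exists>i\<in>{1..s+1}. cmod z = \<rho> i"
    and e_pos: "\<And>i. 1 \<le> i \<Longrightarrow> i \<le> s \<Longrightarrow> e i > 0"
    and A: "A > 0"
    and m: "m \<ge> 1"
    and \<alpha>_pos: "\<And>\<nu>. \<nu> \<ge> m \<Longrightarrow> \<alpha> \<nu> > 0"
    and \<alpha>_lim: "\<alpha> \<longlonglongrightarrow> 0"
    and decomp: "is_direct_sum (solution_space n a m) Vv {1..s+1}"
    and dims: "\<And>i. 1 \<le> i \<Longrightarrow> i \<le> s + 1 \<Longrightarrow> seq.dim (Vv i) = e i"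
    and lower: "\<And>j y \<nu>. 1 \<le> j \<Longrightarrow> j \<le> s \<Longrightarrow> y \<in> Vv j \<Longrightarrow> \<nu> \<ge> m \<Longrightarrow>
        exp (- A * growth_exponent (k j) \<nu>) * \<rho> j ^ \<nu> * omega n y m \<le> omega n y \<nu>"
    and upper: "\<And>j y \<nu>. 1 \<le> j \<Longrightarrow> j \<le> s \<Longrightarrow> y \<in> Vw j \<Longrightarrow> \<nu> \<ge> m \<Longrightarrow>
        omega n y \<nu> \<le> exp (A * growth_exponent (k j) \<nu>) * \<rho> j ^ \<nu> * omega n y m"
    and proj: "\<And>j y \<nu>. 1 \<le> j \<Longrightarrow> j \<le> s \<Longrightarrow> y \<in> Vw j \<Longrightarrow> \<nu> \<ge> m \<Longrightarrow>
        (omega n (direct_sum_proj Vv {j..s+1} j y) m - \<alpha> \<nu> * omega n y m)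
          * \<rho> j ^ \<nu> * exp (- A * growth_exponent (k j) \<nu>) \<le> omega n y \<nu>"
    and zero_part: "\<And>y \<nu>. k (s + 1) > 0 \<Longrightarrow> y \<in> Vv (s + 1) \<Longrightarrow> \<nu> \<ge> m \<Longrightarrow>
        cmod (y \<nu>) \<le> (A / real \<nu>) powr (real \<nu> / real (k (s + 1))) * omega n y m"
    and \<theta>: "1 \<le> \<theta>" "\<theta> \<le> s"
  shows "\<exists>A'>0. \<forall>y\<in>Vs \<theta>. \<forall>\<nu>\<ge>m.
      exp (- A' * growth_exponent (Max (k ` {1..s})) \<nu>) * \<rho> \<theta> ^ \<nu> * omega n y m \<le> omega n y \<nu>"
proof -
  define g where "g = growth_exponent (Max (k ` {1..s}))"
  define V where "V = solution_space n a m"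
  define Y where "Y w = omega n w m" for w
  have k_pos: "1 \<le> k j" if "j \<in> {1..s}" for j
    using mult_max_pos e_pos that unfolding k_def e_def by simp
  have k_max: "k j \<le> Max (k ` {1..s})" if "j \<in> {1..s}" for j
    using that by (intro Max_ge) auto
  have K1: "1 \<le> Max (k ` {1..s})" using order_trans[OF k_pos k_max] \<theta> by force
  have g_ge1: "1 \<le> g \<nu>" if "\<nu> \<ge> 1" for \<nu>
    using growth_exponent_ge_1[OF K1 that] by (simp add: g_def)
  have g_double: "g (\<nu> + h) \<le> 2 * g \<nu>" if "\<nu> \<ge> 2" "h \<le> \<nu>" for \<nu> h
    unfolding g_def by (rule growth_exponent_add_le[OF K1 that])
  have g_sub: "(\<lambda>\<nu>. g \<nu> / real \<nu>) \<longlonglongrightarrow> 0"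
    unfolding g_def by (rule growth_exponent_sublinear[OF K1])
  have g_mono: "growth_exponent (k j) \<nu> \<le> g \<nu>" if "j \<in> {1..s}" "\<nu> \<ge> 1" for j \<nu>
    unfolding g_def using that k_pos k_max by (intro growth_exponent_mono) auto
  have Y_nonneg: "Y w \<ge> 0" for w using omega_nonneg[OF n] by (simp add: Y_def)

  have \<rho>_Suc: "\<rho> (Suc j) < \<rho> j" if "j \<in> {1..s}" for j using \<rho>_decr[of j] that by simp
  have \<rho>_le: "\<rho> j \<le> \<rho> i" if "1 \<le> i" "i \<le> j" "j \<le> s + 1" for i j
    using that(2,3)
  proof (induction j rule: dec_induct)
    case (step j)
    then show ?case using \<rho>_Suc[of j] that(1) by simp
  qed simp
  have \<rho>_pos: "\<rho> j > 0" if "j \<in> {1..s}" for j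
    using \<rho>_Suc[OF that] \<rho>_le[of "Suc j" "s + 1"] \<rho>_last that by simp

  have zero: "0 \<in> Vv j" if "j \<in> {1..s+1}" for j
    using decomp that by (auto simp: is_direct_sum_def intro: seq.subspace_0)
  have sub: "Vv j \<subseteq> V" if "j \<in> {1..s+1}" for j
    using component_subset_sum_space[of "{1..s+1}" j Vv] zero decomp that
    by (simp add: V_def is_direct_sum_def)
  have sum_V: "(\<Sum>l\<in>I. w l) \<in> V" if "\<And>l. l \<in> I \<Longrightarrow> w l \<in> Vv l" "I \<subseteq> {1..s+1}" for I w
    unfolding V_def
  proof (rule seq.subspace_sum[OF subspace_solution_space])
    fix l assume "l \<in> I"
    then have "l \<in> {1..s+1}" "w l \<in> Vv l" using that by blast+
    then show "w l \<in> solution_space n a m" using sub[of l] unfolding V_def by blast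
  qed
  have Vw: "y \<in> Vw j" if j: "j \<in> {1..s}" and y: "y \<in> Vv j" for j y
    using component_subset_sum_space[of "{j..s+1}" j Vv] zero j y unfolding Vw_def by auto

  have lo: "exp (- A * g \<nu>) * (Y y * \<rho> j ^ \<nu>) \<le> omega n y \<nu>"
    if "j \<in> {1..s}" "y \<in> Vv j" "\<nu> \<ge> m" for j y \<nu>
  proof -
    have "exp (- A * g \<nu>) \<le> exp (- A * growth_exponent (k j) \<nu>)"
      using g_mono[of j \<nu>] that m A by simp
    then have "exp (- A * g \<nu>) * (Y y * \<rho> j ^ \<nu>)
        \<le> exp (- A * growth_exponent (k j) \<nu>) * (Y y * \<rho> j ^ \<nu>)"
      using \<rho>_pos[OF that(1)] Y_nonneg by (intro mult_right_mono) auto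
    also have "\<dots> \<le> omega n y \<nu>" using lower[of j y \<nu>] that by (simp add: Y_def mult_ac)
    finally show ?thesis .
  qed
  have up: "omega n y \<nu> \<le> exp (A * g \<nu>) * (Y y * \<rho> j ^ \<nu>)"
    if "j \<in> {1..s}" "y \<in> Vv j" "\<nu> \<ge> m" for j y \<nu>
  proof -
    have "omega n y \<nu> \<le> exp (A * growth_exponent (k j) \<nu>) * (Y y * \<rho> j ^ \<nu>)"
      using upper[of j y \<nu>] Vw that by (simp add: Y_def mult_ac)
    also have "\<dots> \<le> exp (A * g \<nu>) * (Y y * \<rho> j ^ \<nu>)"
      using g_mono[of j \<nu>] that m A \<rho>_pos[OF that(1)] Y_nonneg by (intro mult_right_mono) auto
    finally show ?thesis .
  qed

  obtain K where K: "K > 0"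
    and rec: "\<And>y \<nu> h. y \<in> V \<Longrightarrow> \<nu> \<ge> m \<Longrightarrow> omega n y (\<nu> + h) \<le> K ^ h * omega n y \<nu>"
    unfolding V_def by (rule solution_omega_growth[where a = a and a_lim = a_lim, OF n lead coeffs]) blast+

  have "\<exists>B\<ge>0. \<exists>N\<ge>m. \<forall>w. (\<forall>l\<in>{1..\<theta>}. w l \<in> Vv l) \<longrightarrow> (\<forall>\<nu>\<ge>N.
      exp (- B * g \<nu>) * (\<Sum>l\<in>{1..\<theta>}. omega n (w l) m * \<rho> l ^ \<nu>) \<le> omega n (\<Sum>l\<in>{1..\<theta>}. w l) \<nu>)"
  proof (rule omega_component_sum_lower_bound[OF n g_ge1 g_double g_sub less_imp_le[OF A] K])
    fix l assume "l \<in> {1..\<theta>}"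
    then have l: "l \<in> {1..s}" using \<theta> by auto
    show "\<rho> l > 0" by (rule \<rho>_pos[OF l])
    fix y \<nu> assume "y \<in> Vv l" "\<nu> \<ge> m"
    then show "exp (- A * g \<nu>) * (omega n y m * \<rho> l ^ \<nu>) \<le> omega n y \<nu>"
      and "omega n y \<nu> \<le> exp (A * g \<nu>) * (omega n y m * \<rho> l ^ \<nu>)"
      using lo[OF l] up[OF l] by (auto simp: Y_def)
  next
    fix l assume "l \<in> {1..<\<theta>}"
    then show "\<rho> (Suc l) < \<rho> l" using \<rho>_Suc[of l] \<theta> by simp
  next
    fix i w \<nu> h assume "1 \<le> i" and w: "\<forall>l\<in>{i..\<theta>}. w l \<in> Vv l" and "\<nu> \<ge> m"
    then have "(\<Sum>l\<in>{i..\<theta>}. w l) \<in> V" using \<theta> by (intro sum_V) auto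
    then show "omega n (\<Sum>l\<in>{i..\<theta>}. w l) (\<nu> + h) \<le> K ^ h * omega n (\<Sum>l\<in>{i..\<theta>}. w l) \<nu>"
      by (rule rec) fact
  qed (use \<theta> in auto)
  then obtain B N where B: "B \<ge> 0" and N: "N \<ge> m"
    and comb: "\<And>w \<nu>. \<forall>l\<in>{1..\<theta>}. w l \<in> Vv l \<Longrightarrow> \<nu> \<ge> N \<Longrightarrow>
      exp (- B * g \<nu>) * (\<Sum>l\<in>{1..\<theta>}. Y (w l) * \<rho> l ^ \<nu>) \<le> omega n (\<Sum>l\<in>{1..\<theta>}. w l) \<nu>"
    unfolding Y_def by blast
  \<comment> \<open>Among the exponentials in the total size, \<open>\<rho> \<theta> ^ \<nu>\<close> is the smallest.\<close>
  have late: "exp (- B * g \<nu>) * (\<rho> \<theta> ^ \<nu> * Y y) \<le> omega n y \<nu>" if y: "y \<in> Vs \<theta>" and \<nu>: "\<nu> \<ge> N" for y \<nu>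
  proof -
    obtain w where w: "\<forall>l\<in>{1..\<theta>}. w l \<in> Vv l" and yw: "y = (\<Sum>l\<in>{1..\<theta>}. w l)"
      using y by (auto simp: Vs_def sum_space_def)
    have "Y y \<le> (\<Sum>l\<in>{1..\<theta>}. Y (w l))"
      unfolding Y_def yw by (intro omega_sum_le n) auto
    then have "\<rho> \<theta> ^ \<nu> * Y y \<le> \<rho> \<theta> ^ \<nu> * (\<Sum>l\<in>{1..\<theta>}. Y (w l))"
      using \<rho>_pos[of \<theta>] \<theta> by (intro mult_left_mono) auto
    also have "\<dots> \<le> (\<Sum>l\<in>{1..\<theta>}. Y (w l) * \<rho> l ^ \<nu>)"
      unfolding sum_distrib_left
    proof (rule sum_mono)
      fix l assume "l \<in> {1..\<theta>}"
      then have "\<rho> \<theta> ^ \<nu> \<le> \<rho> l ^ \<nu>"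
        using \<rho>_le[of l \<theta>] \<rho>_pos[of \<theta>] \<theta> by (intro power_mono) auto
      then show "\<rho> \<theta> ^ \<nu> * Y (w l) \<le> Y (w l) * \<rho> l ^ \<nu>"
        using Y_nonneg by (simp add: mult.commute mult_left_mono)
    qed
    finally have "exp (- B * g \<nu>) * (\<rho> \<theta> ^ \<nu> * Y y) \<le> exp (- B * g \<nu>) * (\<Sum>l\<in>{1..\<theta>}. Y (w l) * \<rho> l ^ \<nu>)"
      by (intro mult_left_mono) auto
    also have "\<dots> \<le> omega n y \<nu>" using comb[OF w \<nu>] by (simp only: yw)
    finally show ?thesis .
  qed

  have \<rho>\<theta>: "\<rho> \<theta> > 0" using \<rho>_pos \<theta> by simp
  have g_ge1_m: "g \<nu> \<ge> 1" if "\<nu> \<ge> m" for \<nu> using g_ge1 that m by simp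
  obtain A' where A': "A' > 0" and all: "\<And>t Z \<nu>. Z \<ge> 0 \<Longrightarrow>
      (\<And>\<nu> h. \<nu> \<ge> m \<Longrightarrow> t (\<nu> + h) \<le> K ^ h * t \<nu>) \<Longrightarrow>
      (\<And>\<nu>. \<nu> \<ge> N \<Longrightarrow> exp (- B * g \<nu>) * (\<rho> \<theta> ^ \<nu> * Z) \<le> t \<nu>) \<Longrightarrow>
      \<nu> \<ge> m \<Longrightarrow> exp (- A' * g \<nu>) * (\<rho> \<theta> ^ \<nu> * Z) \<le> t \<nu>"
    by (rule lower_bound_on_initial_segment[OF g_ge1_m \<rho>\<theta> K B N]) blast+
  show ?thesis
  proof (rule exI[of _ A'], intro conjI A' ballI allI impI)
    fix y \<nu> assume y: "y \<in> Vs \<theta>" and \<nu>: "m \<le> \<nu>"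
    obtain w where w: "\<forall>l\<in>{1..\<theta>}. w l \<in> Vv l" and yw: "y = (\<Sum>l\<in>{1..\<theta>}. w l)"
      using y by (auto simp: Vs_def sum_space_def)
    have "y \<in> V" unfolding yw using w \<theta> by (intro sum_V) auto
    have "exp (- A' * g \<nu>) * (\<rho> \<theta> ^ \<nu> * Y y) \<le> omega n y \<nu>"
      by (rule all[OF Y_nonneg rec[OF \<open>y \<in> V\<close>] late[OF y] \<nu>])
    then show "exp (- A' * growth_exponent (Max (k ` {1..s})) \<nu>) * \<rho> \<theta> ^ \<nu> * omega n y m \<le> omega n y \<nu>"
      by (simp add: g_def Y_def mult_ac)
  qed
qed

end
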